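(* The non-zero Askey-Wilson moments for $b=-a$ and $d=-c$ are, for every integer $n\ge0$, $$4^n\mu_{2n}(a,-a,c,-c;q)= \sum_{m=0}^n \frac{(-a^2;q)_{2 m}(a^2c^2;q^2)_{m}}{(qa^2c^2;q^2)_m} q^{2m} \sum_{j=0}^m \frac{a^{-4j} q^{-2j^2} (aq^{j}+ a^{-1}q^{-j})^{2n}} {(q^2,a^4q^{2+4j}; q^2)_{m-j}\, (q^2,a^{-4}q^{2-4j}; q^2)_{j}}.$$
   Context: Let $a,b,c,d,q$ be indeterminates (generic parameters). The monic Askey-Wilson polynomials $P_n(x)=P_n(x;a,b,c,d;q)$ are defined by $P_{-1}=0$, $P_0=1$, $P_{n+1}=(x-b_n)P_n-\lambda_nP_{n-1}$, with $b_n=\frac12(a+a^{-1}-(A_n+C_n))$, $\lambda_n=\frac14A_{n-1}C_n$, where $$A_n=\frac{(1-abq^n)(1-acq^n)(1-adq^n)(1-abcdq^{n-1})}{a(1-abcdq^{2n-1})(1-abcdq^{2n})},\quad C_n=\frac{a(1-q^n)(1-bcq^{n-1})(1-bdq^{n-1})(1-cdq^{n-1})}{(1-abcdq^{2n-2})(1-abcdq^{2n-1})}$$ (for $n=0$ the common factor $1-abcdq^{-1}$ in $A_0$ is cancelled, and $C_0=0$). The moment $\mu_n(a,b,c,d;q)=L(x^n)$, where $L$ is the unique linear functional on polynomials in $x$ with $L(1)=1$ and $L(P_n)=0$ for all $n\ge1$ (so that $L(P_mP_n)=0$ for $m\neq n$). It is a rational function of $a,b,c,d,q$, symmetric in $a,b,c,d$.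 For $b=-a$, $d=-c$ one has $b_n=0$ for all $n$, so the odd moments vanish. Notation: $(x;p)_m=\prod_{i=0}^{m-1}(1-xp^i)$ and $(x,y;p)_m=(x;p)_m(y;p)_m$. *)

theory Defs
  imports Complex_Main "HOL-Computational_Algebra.Polynomial"
begin

definition qpoch :: "'a::field \<Rightarrow> 'a \<Rightarrow> nat \<Rightarrow> 'a" where
  "qpoch x p m = (\<Prod>i<m. 1 - x * p ^ i)"

definition qpoch2 :: "'a::field \<Rightarrow> 'a \<Rightarrow> 'a \<Rightarrow> nat \<Rightarrow> 'a" where
  "qpoch2 x y p m = qpoch x p m * qpoch y p m"

text \<open>For \<open>n = 0\<close> the factor \<open>1 - a b c d q\<^sup>-\<^sup>1\<close>, common to numerator and denominator
  of \<open>A\<^sub>0\<close>, is cancelled; for \<open>n > 0\<close> all exponents below are genuine naturals.\<close>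

definition AW_A :: "'a::field \<Rightarrow> 'a \<Rightarrow> 'a \<Rightarrow> 'a \<Rightarrow> 'a \<Rightarrow> nat \<Rightarrow> 'a" where
  "AW_A a b c d q n =
     (if n = 0
      then (1 - a*b) * (1 - a*c) * (1 - a*d) / (a * (1 - a*b*c*d))
      else (1 - a*b*q^n) * (1 - a*c*q^n) * (1 - a*d*q^n) * (1 - a*b*c*d*q^(n-1))
           / (a * (1 - a*b*c*d*q^(2*n-1)) * (1 - a*b*c*d*q^(2*n))))"

definition AW_C :: "'a::field \<Rightarrow> 'a \<Rightarrow> 'a \<Rightarrow> 'a \<Rightarrow> 'a \<Rightarrow> nat \<Rightarrow> 'a" where
  "AW_C a b c d q n =
     (if n = 0
      then 0
      else a * (1 - q^n) * (1 - b*c*q^(n-1)) * (1 - b*d*q^(n-1)) * (1 - c*d*q^(n-1))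
           / ((1 - a*b*c*d*q^(2*n-2)) * (1 - a*b*c*d*q^(2*n-1))))"

definition AW_b :: "'a::field \<Rightarrow> 'a \<Rightarrow> 'a \<Rightarrow> 'a \<Rightarrow> 'a \<Rightarrow> nat \<Rightarrow> 'a" where
  "AW_b a b c d q n = 1/2 * (a + inverse a - (AW_A a b c d q n + AW_C a b c d q n))"

text \<open>Only the values for \<open>n \<ge> 1\<close> are used: \<open>\<lambda>\<^sub>0\<close> multiplies \<open>P\<^sub>-\<^sub>1 = 0\<close> in the recurrence.\<close>

definition AW_lambda :: "'a::field \<Rightarrow> 'a \<Rightarrow> 'a \<Rightarrow> 'a \<Rightarrow> 'a \<Rightarrow> nat \<Rightarrow> 'a" where
  "AW_lambda a b c d q n = 1/4 * AW_A a b c d q (n-1) * AW_C a b c d q n"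

fun AW_poly :: "'a::field \<Rightarrow> 'a \<Rightarrow> 'a \<Rightarrow> 'a \<Rightarrow> 'a \<Rightarrow> nat \<Rightarrow> 'a poly" where
  "AW_poly a b c d q 0 = 1"
| "AW_poly a b c d q (Suc 0) = [:- AW_b a b c d q 0, 1:]"
| "AW_poly a b c d q (Suc (Suc n)) =
     [:- AW_b a b c d q (Suc n), 1:] * AW_poly a b c d q (Suc n)
     - smult (AW_lambda a b c d q (Suc n)) (AW_poly a b c d q n)"

definition is_AW_functional ::
    "'a::field \<Rightarrow> 'a \<Rightarrow> 'a \<Rightarrow> 'a \<Rightarrow> 'a \<Rightarrow> ('a poly \<Rightarrow> 'a) \<Rightarrow> bool" where
  "is_AW_functional a b c d q L \<longleftrightarrow>
     Vector_Spaces.linear smult (*) L \<and> L 1 = 1 \<and> (\<forall>n\<ge>1. L (AW_poly a b c d q n) = 0)"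

definition AW_functional ::
    "'a::field \<Rightarrow> 'a \<Rightarrow> 'a \<Rightarrow> 'a \<Rightarrow> 'a \<Rightarrow> 'a poly \<Rightarrow> 'a" where
  "AW_functional a b c d q = (THE L. is_AW_functional a b c d q L)"

definition AW_moment :: "'a::field \<Rightarrow> 'a \<Rightarrow> 'a \<Rightarrow> 'a \<Rightarrow> 'a \<Rightarrow> nat \<Rightarrow> 'a" where
  "AW_moment a b c d q n = AW_functional a b c d q (monom 1 n)"

text \<open>The description of \<^const>\<open>AW_functional\<close> is justified: the functional exists and is unique.\<close>

lemma AW_poly_monic:
  "degree (AW_poly a b c d q n) = n \<and> coeff (AW_poly a b c d q n) n = 1"
proof (induction a b c d q n rule: AW_poly.induct)
  case (3 a b c d q n)
  let ?P = "AW_poly a b c d q (Suc n)" and ?R = "smult (AW_lambda a b c d q (Suc n)) (AW_poly a b c d q n)"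
  have ne: "?P \<noteq> 0" using 3 by auto
  have d: "degree ([:- AW_b a b c d q (Suc n), 1:] * ?P) = Suc (Suc n)"
    using 3 ne by (subst degree_mult_eq) auto
  have r: "degree ?R < Suc (Suc n)"
    using 3 degree_smult_le[of "AW_lambda a b c d q (Suc n)" "AW_poly a b c d q n"] by linarith
  have "coeff ?P (Suc (Suc n)) = 0" using 3 by (simp add: coeff_eq_0)
  hence lc: "coeff (AW_poly a b c d q (Suc (Suc n))) (Suc (Suc n)) = 1"
    using 3 coeff_eq_0[OF r] by simp
  have "degree (AW_poly a b c d q (Suc (Suc n))) \<le> Suc (Suc n)"
    unfolding AW_poly.simps(3) using d r by (intro degree_diff_le) linarith+
  moreover have "degree (AW_poly a b c d q (Suc (Suc n))) \<ge> Suc (Suc n)"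
    using lc by (intro le_degree) simp
  ultimately show ?case using lc by (intro conjI antisym)
qed simp_all

lemma linear_poly_functional_iff:
  "Vector_Spaces.linear smult (*) (L :: 'a::field poly \<Rightarrow> 'a) \<longleftrightarrow>
     (\<forall>p r. L (p + r) = L p + L r) \<and> (\<forall>k p. L (smult k p) = k * L p)"
proof -
  have "vector_space (smult :: 'a \<Rightarrow> 'a poly \<Rightarrow> 'a poly)" "vector_space ((*) :: 'a \<Rightarrow> 'a \<Rightarrow> 'a)"
    by (unfold_locales; simp add: smult_add_right smult_add_left algebra_simps)+
  thus ?thesis
    by (auto simp: Vector_Spaces.linear_iff)
qed

lemma AW_functional_ex1:
  fixes a b c d q :: "'a::field"
  shows "\<exists>!L. is_AW_functional a b c d q L"
proof -
  let ?P = "AW_poly a b c d q"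
  note P = AW_poly_monic[of a b c d q]
  define R where "R = (\<lambda>f n. if n = 0 then 1 else - (\<Sum>i<n. coeff (?P n) i * f i))"
  define mu where "mu = wfrec less_than R"
  have mu: "mu n = (if n = 0 then 1 else - (\<Sum>i<n. coeff (?P n) i * mu i))" for n
  proof -
    have "mu n = R (cut mu less_than n) n"
      unfolding mu_def by (rule wfrec) simp
    thus ?thesis by (simp add: R_def cut_def)
  qed
  define L where "L = (\<lambda>p. \<Sum>i\<le>degree p. coeff p i * mu i)"
  have L: "L p = (\<Sum>i\<le>N. coeff p i * mu i)" if "degree p \<le> N" for p N
    unfolding L_def using that
    by (intro sum.mono_neutral_left) (auto simp: coeff_eq_0)
  have "L (p + r) = L p + L r" for p r
  proof -
    let ?N = "max (degree p) (degree r)"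
    have "degree (p + r) \<le> ?N" by (rule degree_add_le_max)
    thus ?thesis
      by (simp add: L[of _ ?N] sum.distrib distrib_right)
  qed
  moreover have "L (smult k p) = k * L p" for k p
    using L[of "smult k p" "degree p"] L[of p "degree p"] degree_smult_le[of k p]
    by (simp add: sum_distrib_left mult.assoc)
  moreover have "L 1 = 1" by (simp add: L_def mu[of 0])
  moreover have "L (?P n) = 0" if "n \<ge> 1" for n
  proof -
    have "L (?P n) = (\<Sum>i<n. coeff (?P n) i * mu i) + mu n"
      using L[of "?P n" n] P[of n] by (simp add: lessThan_Suc_atMost[symmetric])
    thus ?thesis using that by (simp add: mu[of n])
  qed
  ultimately have ex: "is_AW_functional a b c d q L"
    unfolding is_AW_functional_def linear_poly_functional_iff by blast
  have "L' p = L p" if L': "is_AW_functional a b c d q L'" for L' p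
  proof (induction "degree p" arbitrary: p rule: less_induct)
    case less
    let ?n = "degree p"
    let ?k = "lead_coeff p"
    let ?r = "p - smult ?k (?P ?n)"
    have add: "M (x + y) = M x + M y" and sm: "M (smult k x) = k * M x"
      if "is_AW_functional a b c d q M" for M x y k
      using that unfolding is_AW_functional_def linear_poly_functional_iff by auto
    have split: "M p = M ?r + ?k * M (?P ?n)" if "is_AW_functional a b c d q M" for M
      using add[OF that, of ?r "smult ?k (?P ?n)"] sm[OF that, of ?k "?P ?n"] by simp
    have PP: "L' (?P ?n) = L (?P ?n)"
      using L' ex unfolding is_AW_functional_def by (cases "?n = 0") auto
    have "L' ?r = L ?r"
    proof (cases "?n = 0")
      case True
      then obtain k where "p = [:k:]" by (metis degree_eq_zeroE)
      hence "?r = 0" by (simp add: one_pCons)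
      thus ?thesis using sm[OF L', of 0 0] sm[OF ex, of 0 0] by simp
    next
      case False
      have "coeff ?r ?n = 0" using P[of ?n] by simp
      moreover have "degree ?r \<le> ?n"
        using P[of ?n] by (intro degree_diff_le order.trans[OF degree_smult_le]) auto
      ultimately have "degree ?r < ?n"
        using False by (metis degree_0 le_neq_implies_less leading_coeff_0_iff neq0_conv)
      thus ?thesis by (rule less)
    qed
    thus ?case using split[OF L'] split[OF ex] PP by simp
  qed
  hence "L' = L" if "is_AW_functional a b c d q L'" for L'
    using that by (intro ext)
  thus ?thesis using ex by (intro ex1I[of _ L])
qed

end

theory Submission
  imports Defs
begin

text \<open>Let $p = q^2$, $Y = 4x^2$ and $f_k = \prod_{i<k} ((1 + a^2 p^i)^2 - a^2 p^i Y)$. Since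
  $b_n = 0$, the even polynomials $E_n = 4^n P_{2n}$ and $F_n = 4^{n+1} x P_{2n+1}$ satisfy
  $E_{n+1} = F_n - 4\lambda_{2n+1} E_n$ and $F_n = Y E_n - 4\lambda_{2n} F_{n-1}$. Together with
  $L(E_n f_0) = \delta_{n0}$ this determines all mixed moments $L(E_n f_k)$ and $L(F_n f_k)$ by
  induction on $k$, and they are pure products, because $L(E_n f_k)$ is a $q$-Saalschuetz sum.
  The case $n = 0$ gives $L(f_k)$. Finally
  $Y^n$ is expanded in the $f_k$ by Newton interpolation at their zeros
  $(a q^j + a^{-1} q^{-j})^2$; the inner sum of the theorem is, up to a factor, the divided
  difference of $y^n$ at the first $m + 1$ of them. The odd moments vanish because $L$ is
  invariant under $x \mapsto -x$.\<close>

section \<open>Shifted factorials and closed forms of the mixed moments\<close>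

lemma qpoch_0 [simp]: "qpoch x p 0 = 1"
  by (simp add: qpoch_def)

lemma qpoch_Suc [simp]: "qpoch x p (Suc m) = qpoch x p m * (1 - x * p ^ m)"
  by (simp add: qpoch_def)

lemma qpoch_nonzero: "(\<And>i. i < m \<Longrightarrow> x * p ^ i \<noteq> 1) \<Longrightarrow> qpoch x p m \<noteq> 0"
  unfolding qpoch_def by (auto simp: prod_zero_iff)

text \<open>For \<open>k >= n\<close> and \<open>p\<close> not a root of unity this is p^(n(n-1)/2)
  (p;p)_k / (p;p)_(k-n). The division-free form also covers \<open>k < n\<close>, where it is
  0.\<close>

definition lowfac :: "'a::field \<Rightarrow> nat \<Rightarrow> nat \<Rightarrow> 'a" where
  "lowfac p n k = (\<Prod>i<n. p ^ i - p ^ k)"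

lemma lowfac_simps [simp]:
  "lowfac p 0 k = 1"
  "lowfac p (Suc n) k = lowfac p n k * (p ^ n - p ^ k)"
  by (simp_all add: lowfac_def)

lemma lowfac_Suc_0: "lowfac p (Suc n) 0 = 0"
  unfolding lowfac_def by (rule prod_zero) (auto intro!: bexI[of _ 0])

text \<open>The factor for i = 0 splits off, and each of the other n factors releases one p.\<close>

lemma lowfac_Suc_Suc: "lowfac p (Suc n) (Suc k) = (1 - p ^ Suc k) * p ^ n * lowfac p n k"
proof (induction n)
  case (Suc n)
  have "lowfac p (Suc (Suc n)) (Suc k) = lowfac p (Suc n) (Suc k) * (p ^ Suc n - p ^ Suc k)"
    by simp
  also have "\<dots> = (1 - p ^ Suc k) * p ^ Suc n * (lowfac p n k * (p ^ n - p ^ k))"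
    unfolding Suc.IH by (simp add: algebra_simps)
  finally show ?case by simp
qed (simp add: lowfac_def)

text \<open>\<open>rec_coeff\<close> is $4\lambda_n$ for $A = a^2$, $B = c^2$ and $n \ge 1$ (junk for $n = 0$). In the general
  formula, $n = 1$ would give the factor $1 - AB/q$ in both numerator and denominator.\<close>

definition rec_coeff :: "'a::field \<Rightarrow> 'a \<Rightarrow> 'a \<Rightarrow> nat \<Rightarrow> 'a" where
  "rec_coeff A B q n =
     (if n = 1 then (1 + A) * (1 - q) * (1 + B) / (1 - A*B*q)
      else (1 + A*q^(n-1)) * (1 - A*B*q^(n-2)) * (1 - q^n) * (1 + B*q^(n-1))
           / ((1 - A*B*q^(2*n-3)) * (1 - A*B*q^(2*n-1))))"

text \<open>The factor that passes from the constant of E_n to that of F_n. At n = 0 the general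
  formula would have 1 - AB/q both above and below, hence the separate case.\<close>

definition norm_ratio :: "'a::field \<Rightarrow> 'a \<Rightarrow> 'a \<Rightarrow> nat \<Rightarrow> 'a" where
  "norm_ratio A B q n =
     (if n = 0 then (1 - q) * (1 + B)
      else (1 - A*B*q^(2*n-1)) * (1 - q^(2*n+1)) * (1 + B*q^(2*n)) / (1 - A*B*q^(4*n-1)))"

text \<open>The step is forced by \<open>even_mixed_Suc\<close>: the difference there contributes
  the new factor of \<open>lowfac\<close>, and what remains independent of k is collected
  here.\<close>

primrec norm_const :: "'a::field \<Rightarrow> 'a \<Rightarrow> 'a \<Rightarrow> nat \<Rightarrow> 'a" where
  "norm_const A B q 0 = 1"
| "norm_const A B q (Suc n) =
     - (norm_const A B q n * norm_ratio A B q n * A * (1 + B*q^(2*n+1)) / (1 - A*B*q^(4*n+1)))"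

text \<open>The products $L(E_n f_k)$ and $L(F_n f_k)$. The factor \<open>lowfac\<close> makes them vanish for $k < n$,
  as orthogonality requires.\<close>

definition even_mixed :: "'a::field \<Rightarrow> 'a \<Rightarrow> 'a \<Rightarrow> nat \<Rightarrow> nat \<Rightarrow> 'a" where
  "even_mixed A B q n k =
     norm_const A B q n * qpoch (A*B) (q^2) k * qpoch (-A) q (2*k) * lowfac (q^2) n k
     / qpoch (q*A*B) (q^2) (n + k)"

definition odd_mixed :: "'a::field \<Rightarrow> 'a \<Rightarrow> 'a \<Rightarrow> nat \<Rightarrow> nat \<Rightarrow> 'a" where
  "odd_mixed A B q n k =
     norm_const A B q n * norm_ratio A B q n * qpoch (A*B) (q^2) k * qpoch (-A) q (2*k+1)
     * lowfac (q^2) n k / qpoch (q*A*B) (q^2) (n + k + 1)"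

section \<open>Recurrences of the closed forms\<close>

context
  fixes A B q :: "'a::field"
  assumes AB: "\<And>k. A * B * q ^ k \<noteq> 1"
begin

lemma denominator_nonzero: "1 - A*B*q^k \<noteq> 0"
  using AB[of k] by auto

lemma qpoch_denominator_nonzero: "qpoch (q*A*B) (q^2) k \<noteq> 0"
  using AB[of "Suc (2 * i)" for i]
  by (intro qpoch_nonzero) (simp add: power_mult[symmetric] mult_ac)

lemma rec_coeff_odd:
  "rec_coeff A B q (2*n+1) = norm_ratio A B q n * (1 + A*q^(2*n)) / (1 - A*B*q^(4*n+1))"
proof (cases n)
  case (Suc m)
  have [simp]: "2 * Suc m + 1 = Suc (2 * m + 2)" by simp
  show ?thesis
    unfolding Suc rec_coeff_def norm_ratio_def by (simp add: algebra_simps numeral_eq_Suc)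
qed (simp add: rec_coeff_def norm_ratio_def)

text \<open>After division by the common product K, the right side is linear in u = q^(2k) and
  vanishes at u = w = q^(2n). This produces the factor w - u that extends
  \<open>lowfac\<close>.\<close>

lemma even_mixed_Suc:
  "even_mixed A B q (Suc n) k = odd_mixed A B q n k - rec_coeff A B q (2*n+1) * even_mixed A B q n k"
proof -
  define w u where "w = q^(2*n)" and "u = q^(2*k)"
  define K where "K = norm_const A B q n * norm_ratio A B q n * qpoch (A*B) (q^2) k
     * qpoch (-A) q (2*k) * lowfac (q^2) n k / qpoch (q*A*B) (q^2) (Suc (n + k))"
  have pw: "q^(4*n+1) = q*w^2" "q^(2*n+1) = q*w" "(q^2)^n = w" "(q^2)^k = u" "q^(2*k) = u"
    "(q^2)^(n+k) = w*u" "q^(2*n) = w"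
    by (simp_all add: w_def u_def power_mult[symmetric] power_add[symmetric] ac_simps)
  have nz: "1 - A*B*(q*w^2) \<noteq> 0" "qpoch (q*A*B) (q^2) (n+k) \<noteq> 0" "1 - q*A*B*(w*u) \<noteq> 0"
    using denominator_nonzero[of "4*n+1"] qpoch_denominator_nonzero[of "n+k"] qpoch_denominator_nonzero[of "Suc (n+k)"]
    by (simp_all only: pw qpoch_Suc) auto
  define V h where "V = qpoch (q*A*B) (q^2) (n + k)" and "h = 1 - q*A*B*(w*u)"
  have K_eq: "K = norm_const A B q n * norm_ratio A B q n * qpoch (A*B) (q^2) k
     * qpoch (-A) q (2*k) * lowfac (q^2) n k / (V * h)"
    unfolding K_def qpoch_Suc[of _ _ "n+k"] pw V_def h_def ..
  have 1: "even_mixed A B q (Suc n) k = K * (- (A * (1 + B*(q*w)) / (1 - A*B*(q*w^2)) * (w - u)))"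
    unfolding even_mixed_def K_def norm_const.simps lowfac_simps add_Suc pw by (simp add: ac_simps)
  have 2: "odd_mixed A B q n k = K * (1 + A*u)"
    unfolding odd_mixed_def K_def by (simp add: pw)
  have 3: "rec_coeff A B q (2*n+1) * even_mixed A B q n k
     = K * ((1 + A*w) / (1 - A*B*(q*w^2)) * (1 - q*A*B*(w*u)))"
    using nz unfolding even_mixed_def K_eq rec_coeff_odd pw V_def[symmetric] h_def[symmetric]
    by (simp add: ac_simps)
  have "- (A * (1 + B*(q*w)) / (1 - A*B*(q*w^2)) * (w - u))
     = (1 + A*u) - (1 + A*w) / (1 - A*B*(q*w^2)) * (1 - q*A*B*(w*u))"
    using nz(1) by (simp add: divide_simps) (simp add: algebra_simps power2_eq_square)
  then show ?thesis
    unfolding 1 2 3 by (simp only: right_diff_distrib)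
qed

text \<open>Counterpart of f_(k+1) = ((1 + Au)^2 - Au Y) f_k under L, with Y E_0 = F_0. It is
  separate because there is no F_(-1).\<close>

lemma even_mixed_0_Suc:
  "even_mixed A B q 0 (Suc k) =
     (1 + A*q^(2*k))^2 * even_mixed A B q 0 k - A*q^(2*k) * odd_mixed A B q 0 k"
proof -
  define u where "u = q^(2*k)"
  define K where "K = qpoch (A*B) (q^2) k
     * qpoch (-A) q (2*k) / qpoch (q*A*B) (q^2) (Suc k)"
  have pw: "(q^2)^k = u" "q^(2*k) = u" "q^Suc (2*k) = q*u"
    by (simp_all add: u_def power_mult[symmetric])
  have nz: "qpoch (q*A*B) (q^2) k \<noteq> 0" "1 - q*A*B*u \<noteq> 0"
    using qpoch_denominator_nonzero[of k] qpoch_denominator_nonzero[of "Suc k"]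
    by (simp_all only: pw qpoch_Suc) auto
  have 1: "even_mixed A B q 0 (Suc k) = K * ((1 - A*B*u) * (1 + A*u) * (1 + A*(q*u)))"
    unfolding even_mixed_def K_def by (simp add: pw del: power_Suc)
  have 2: "even_mixed A B q 0 k = K * (1 - q*A*B*u)"
    using nz unfolding even_mixed_def K_def by (simp add: pw)
  have 3: "odd_mixed A B q 0 k = K * ((1 - q) * (1 + B) * (1 + A*u))"
    unfolding odd_mixed_def K_def norm_ratio_def by (simp add: pw)
  show ?thesis
    unfolding 1 2 3 pw by (simp add: algebra_simps power2_eq_square)
qed

text \<open>Counterpart of the same step for f_k, with Y E_(n+1) = F_(n+1) + 4 lambda_(2n+2) F_n.
  All four terms share the product K.\<close>

lemma even_mixed_Suc_Suc:
  "even_mixed A B q (Suc n) (Suc k) =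
     (1 + A*q^(2*k))^2 * even_mixed A B q (Suc n) k
     - A*q^(2*k) * (odd_mixed A B q (Suc n) k + rec_coeff A B q (2*n+2) * odd_mixed A B q n k)"
proof -
  define w u where "w = q^(2*n)" and "u = q^(2*k)"
  define K where "K = norm_const A B q n * norm_ratio A B q n * qpoch (A*B) (q^2) k
     * qpoch (-A) q (2*k) * lowfac (q^2) n k / qpoch (q*A*B) (q^2) (Suc (Suc (n + k)))"
  define E1 E3 where "E1 = 1 - A*B*(q*w^2)" and "E3 = 1 - A*B*(q^3*w^2)"
  have pw: "q^(4*n+1) = q*w^2" "q^(4*n+3) = q^3*w^2" "q^(2*n+1) = q*w"
    "q^(2*n+2) = q^2*w" "q^(2*n+3) = q^3*w" "(q^2)^n = w" "(q^2)^k = u" "q^(2*k) = u"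
    "(q^2)^(n+k) = w*u" "(q^2)^Suc (n+k) = q^2*(w*u)" "q^(2*n) = w" "q^Suc (2*k) = q*u"
    "(q^2)^Suc k = q^2*u"
    by (simp_all add: w_def u_def power_mult[symmetric] power_add[symmetric] power_Suc[symmetric] ac_simps
        del: power_Suc)
  have nz: "E1 \<noteq> 0" "E3 \<noteq> 0" "qpoch (q*A*B) (q^2) (Suc (n+k)) \<noteq> 0" "1 - q*A*B*(q^2*(w*u)) \<noteq> 0"
    using denominator_nonzero[of "4*n+1"] denominator_nonzero[of "4*n+3"]
      qpoch_denominator_nonzero[of "Suc (n+k)"] qpoch_denominator_nonzero[of "Suc (Suc (n+k))"]
    unfolding pw E1_def E3_def by (simp_all only: pw qpoch_Suc) auto
  have nr: "norm_ratio A B q (Suc n) = (1 - A*B*(q*w)) * (1 - q^3*w) * (1 + B*(q^2*w)) / E3"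
  proof -
    have "2 * Suc n - 1 = 2*n+1" "2 * Suc n + 1 = 2*n+3" "2 * Suc n = 2*n+2" "4 * Suc n - 1 = 4*n+3"
      by simp_all
    then show ?thesis
      unfolding norm_ratio_def E3_def by (simp only: pw) simp
  qed
  have rc: "rec_coeff A B q (2*n+2) =
      (1 + A*(q*w)) * (1 - A*B*w) * (1 - q^2*w) * (1 + B*(q*w)) / (E1 * E3)"
  proof -
    have "2*n+2-1 = 2*n+1" "2*n+2-2 = 2*n" "2*(2*n+2)-3 = 4*n+1" "2*(2*n+2)-1 = 4*n+3" "2*n+2 \<noteq> 1"
      by simp_all
    then show ?thesis
      unfolding rec_coeff_def E1_def E3_def by (simp only: pw if_False)
  qed
  have nc: "norm_const A B q (Suc n) =
      norm_const A B q n * norm_ratio A B q n * (- (A * (1 + B*(q*w)) / E1))"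
    unfolding norm_const.simps pw E1_def by simp
  have 1: "even_mixed A B q (Suc n) (Suc k) =
      K * (- (A * (1 + B*(q*w)) / E1) * ((1 + A*u) * ((1 - A*B*u) * (1 + A*(q*u)) * (1 - q^2*u) * w)))"
  proof -
    have "qpoch (-A) q (2 * Suc k) = qpoch (-A) q (2*k) * ((1 + A*u) * (1 + A*(q*u)))"
      by (simp add: pw del: power_Suc)
    then show ?thesis
      unfolding even_mixed_def K_def nc lowfac_Suc_Suc by (simp add: pw del: power_Suc; simp add: ac_simps)
  qed
  have 2: "even_mixed A B q (Suc n) k =
      K * (- (A * (1 + B*(q*w)) / E1) * ((w - u) * (1 - q*A*B*(q^2*(w*u)))))"
  proof -
    have "K = norm_const A B q n * norm_ratio A B q n * qpoch (A*B) (q^2) k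
     * qpoch (-A) q (2*k) * lowfac (q^2) n k / (qpoch (q*A*B) (q^2) (Suc (n + k)) * (1 - q*A*B*(q^2*(w*u))))"
      unfolding K_def qpoch_Suc[of _ _ "Suc (n+k)"] pw ..
    then show ?thesis
      using nz unfolding even_mixed_def nc by (simp add: pw del: power_Suc qpoch_Suc; simp add: ac_simps)
  qed
  have 3: "odd_mixed A B q (Suc n) k =
      K * (- (A * (1 + B*(q*w)) / E1) * ((1 - A*B*(q*w)) * (1 - q^3*w) * (1 + B*(q^2*w)) / E3
        * ((1 + A*u) * (w - u))))"
  proof -
    have "qpoch (-A) q (2 * k + 1) = qpoch (-A) q (2*k) * (1 + A*u)"
      by (simp add: pw)
    then show ?thesis
      unfolding odd_mixed_def K_def nc nr by (simp add: pw del: power_Suc qpoch_Suc; simp add: ac_simps)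
  qed
  have 4: "odd_mixed A B q n k = K * ((1 + A*u) * (1 - q*A*B*(q^2*(w*u))))"
  proof -
    have "K = norm_const A B q n * norm_ratio A B q n * qpoch (A*B) (q^2) k
     * qpoch (-A) q (2*k) * lowfac (q^2) n k / (qpoch (q*A*B) (q^2) (Suc (n + k)) * (1 - q*A*B*(q^2*(w*u))))"
      unfolding K_def qpoch_Suc[of _ _ "Suc (n+k)"] pw ..
    moreover have "qpoch (-A) q (2 * k + 1) = qpoch (-A) q (2*k) * (1 + A*u)"
      by (simp add: pw)
    ultimately show ?thesis
      using nz unfolding odd_mixed_def by (simp add: pw del: power_Suc qpoch_Suc; simp add: ac_simps)
  qed
  have distr: "K * (v*y - r*(z + g*h)) = v*(K*y) - r*(K*z + g*(K*h))" for g h r v y z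
    by (simp add: algebra_simps)
  \<comment> \<open>The polynomial factors are kept opaque because expanding them makes \<open>field_simps\<close> too slow.\<close>
  have clear: "- (A*t/E1) * (v*x) = v^2 * (- (A*t/E1) * y)
      - A*u * (- (A*t/E1) * (z/E3 * (v*d)) + g*t/(E1*E3) * (v*h))"
    if "- (x*E3) = - (v*y*E3) + A*u*(z*d) - u*(g*h)" for d g h t u v x y z
  proof -
    have "- (A*t/E1) * (v*x) = A*t*v * (- (x*E3)) / (E1*E3)"
      using nz by simp
    also have "\<dots> = A*t*v * (- (v*y*E3) + A*u*(z*d) - u*(g*h)) / (E1*E3)"
      unfolding that ..
    also have "\<dots> = v^2 * (- (A*t/E1) * y)
      - A*u * (- (A*t/E1) * (z/E3 * (v*d)) + g*t/(E1*E3) * (v*h))"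
      using nz by (simp add: field_simps power2_eq_square)
    finally show ?thesis .
  qed
  \<comment> \<open>The recurrence after cancelling A (1 + Bqw)(1 + Au) / (E1 E3) and K: a
    polynomial identity in A, B, q, w, u.\<close>
  have "- ((1 - A*B*u) * (1 + A*(q*u)) * (1 - q^2*u) * w * E3)
      = - ((1 + A*u) * ((w - u) * (1 - q*A*B*(q^2*(w*u)))) * E3)
        + A*u * ((1 - A*B*(q*w)) * (1 - q^3*w) * (1 + B*(q^2*w)) * (w - u))
        - u * ((1 + A*(q*w)) * (1 - A*B*w) * (1 - q^2*w) * (1 - q*A*B*(q^2*(w*u))))"
    unfolding E3_def by algebra
  then have "- (A * (1 + B*(q*w)) / E1) * ((1 + A*u) * ((1 - A*B*u) * (1 + A*(q*u)) * (1 - q^2*u) * w))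
    = (1 + A*u)^2 * (- (A * (1 + B*(q*w)) / E1) * ((w - u) * (1 - q*A*B*(q^2*(w*u)))))
      - A*u * (- (A * (1 + B*(q*w)) / E1) * ((1 - A*B*(q*w)) * (1 - q^3*w) * (1 + B*(q^2*w)) / E3
          * ((1 + A*u) * (w - u)))
        + (1 + A*(q*w)) * (1 - A*B*w) * (1 - q^2*w) * (1 + B*(q*w)) / (E1 * E3)
          * ((1 + A*u) * (1 - q*A*B*(q^2*(w*u)))))"
    by (rule clear)
  then have "K * (- (A * (1 + B*(q*w)) / E1) * ((1 + A*u) * ((1 - A*B*u) * (1 + A*(q*u)) * (1 - q^2*u) * w)))
    = K * ((1 + A*u)^2 * (- (A * (1 + B*(q*w)) / E1) * ((w - u) * (1 - q*A*B*(q^2*(w*u)))))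
      - A*u * (- (A * (1 + B*(q*w)) / E1) * ((1 - A*B*(q*w)) * (1 - q^3*w) * (1 + B*(q^2*w)) / E3
          * ((1 + A*u) * (w - u)))
        + (1 + A*(q*w)) * (1 - A*B*w) * (1 - q^2*w) * (1 + B*(q*w)) / (E1 * E3)
          * ((1 + A*u) * (1 - q*A*B*(q^2*(w*u))))))"
    by (rule arg_cong)
  then show ?thesis
    unfolding 1 2 3 4 rc pw distr .
qed

text \<open>Column k of M determines column k of N, and together they determine column k + 1 of M.
  The closed forms obey the same rules and agree in column 0.\<close>

theorem mixed_moments_eqI:
  fixes M N :: "nat \<Rightarrow> nat \<Rightarrow> 'a"
  assumes "M 0 0 = 1" and "\<And>n. M (Suc n) 0 = 0"
    and N: "\<And>n k. N n k = M (Suc n) k + rec_coeff A B q (2*n+1) * M n k"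
    and M0: "\<And>k. M 0 (Suc k) = (1 + A*q^(2*k))^2 * M 0 k - A*q^(2*k) * N 0 k"
    and MS: "\<And>n k. M (Suc n) (Suc k) = (1 + A*q^(2*k))^2 * M (Suc n) k
         - A*q^(2*k) * (N (Suc n) k + rec_coeff A B q (2*n+2) * N n k)"
  shows "M n k = even_mixed A B q n k"
proof (induction k arbitrary: n)
  case 0
  show ?case
    using assms(1,2) by (cases n) (simp_all add: even_mixed_def lowfac_Suc_0 del: lowfac_simps(2))
next
  case (Suc k)
  have "N n k = odd_mixed A B q n k" for n
    by (simp add: N Suc.IH even_mixed_Suc)
  then show ?case
    by (cases n) (simp_all only: M0 MS Suc.IH even_mixed_0_Suc even_mixed_Suc_Suc)
qed

end

section \<open>Divided differences and Newton interpolation\<close>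

text \<open>Lagrange form. Indexing by a set allows any node to be removed, not only the
  last.\<close>

definition divdiff :: "('b \<Rightarrow> 'a::field) \<Rightarrow> 'b set \<Rightarrow> ('a \<Rightarrow> 'a) \<Rightarrow> 'a" where
  "divdiff y S g = (\<Sum>j\<in>S. g (y j) / (\<Prod>i\<in>S - {j}. y j - y i))"

lemma divdiff_add: "divdiff y S (\<lambda>x. g x + h x) = divdiff y S g + divdiff y S h"
  by (simp add: divdiff_def add_divide_distrib sum.distrib)

lemma divdiff_scale: "divdiff y S (\<lambda>x. k * g x) = k * divdiff y S g"
  by (simp add: divdiff_def sum_distrib_left)

text \<open>The term of index i vanishes; in every other term the new factor cancels one factor of
  the denominator.\<close>

lemma divdiff_mult_root:
  assumes "finite S" and "i \<in> S" and "inj_on y S"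
  shows "divdiff y S (\<lambda>x. (x - y i) * g x) = divdiff y (S - {i}) g"
proof -
  have "divdiff y S (\<lambda>x. (x - y i) * g x)
      = (\<Sum>j\<in>S - {i}. (y j - y i) * g (y j) / (\<Prod>l\<in>S - {j}. y j - y l))"
    unfolding divdiff_def using assms(1,2) by (subst sum.remove[of S i]) simp_all
  also have "\<dots> = divdiff y (S - {i}) g"
    unfolding divdiff_def
  proof (rule sum.cong[OF refl])
    fix j assume j: "j \<in> S - {i}"
    have "(\<Prod>l\<in>S - {j}. y j - y l) = (y j - y i) * (\<Prod>l\<in>S - {j} - {i}. y j - y l)"
      using assms j by (intro prod.remove) auto
    moreover have "S - {j} - {i} = S - {i} - {j}" by auto
    moreover have "y j - y i \<noteq> 0" using assms j by (auto dest: inj_onD)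
    ultimately show "(y j - y i) * g (y j) / (\<Prod>l\<in>S - {j}. y j - y l)
        = g (y j) / (\<Prod>l\<in>S - {i} - {j}. y j - y l)"
      by simp
  qed
  finally show ?thesis .
qed

text \<open>The constant y_l - y_i equals (x - y_i) - (x - y_l), which gives a difference of two
  divided differences with one node fewer. These are both 1 for two nodes and both 0 by induction
  otherwise.\<close>

lemma divdiff_one_eq_0:
  assumes "finite S" and "inj_on y S" and "card S \<ge> 2"
  shows "divdiff y S (\<lambda>x. 1) = 0"
  using assms
proof (induction "card S" arbitrary: S rule: less_induct)
  case less
  obtain i l where il: "i \<in> S" "l \<in> S" "i \<noteq> l"
    using less.prems(3) card_le_Suc0_iff_eq[OF less.prems(1)] by (auto simp: numeral_2_eq_2)
  have "(y l - y i) * divdiff y S (\<lambda>x. 1) = divdiff y S (\<lambda>x. (x - y i) * 1 + (- 1) * ((x - y l) * 1))"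
    unfolding divdiff_scale[symmetric] by (simp add: divdiff_def)
  also have "\<dots> = divdiff y (S - {i}) (\<lambda>x. 1) - divdiff y (S - {l}) (\<lambda>x. 1)"
    unfolding divdiff_add divdiff_scale divdiff_mult_root[OF less.prems(1) il(1) less.prems(2)]
      divdiff_mult_root[OF less.prems(1) il(2) less.prems(2)] by simp
  also have "\<dots> = 0"
  proof (cases "card S = 2")
    case True
    then have "S = {i, l}"
      using il by (intro card_seteq[symmetric]) (auto simp: less.prems(1))
    with il show ?thesis by (simp add: divdiff_def insert_Diff_if)
  next
    case False
    have "divdiff y (S - {j}) (\<lambda>x. 1) = 0" if "j \<in> S" for j
    proof (rule less.hyps)
      show "card (S - {j}) < card S" "2 \<le> card (S - {j})"
        using that False less.prems by (auto simp: card_gt_0_iff)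
    qed (use less.prems in \<open>auto intro: inj_on_subset\<close>)
    with il show ?thesis by simp
  qed
  finally show ?case using il less.prems(2) by (auto dest: inj_onD)
qed

context
  fixes y :: "nat \<Rightarrow> 'a::field"
  assumes inj: "inj y"
begin

lemma divdiff_power_0: "divdiff y {..0} (\<lambda>x. x ^ n) = y 0 ^ n"
  by (simp add: divdiff_def)

text \<open>For n >= m the divided difference of x^n at m + 1 nodes is the complete homogeneous
  symmetric polynomial of degree n - m; this is its recurrence in the last variable.\<close>

lemma divdiff_power_Suc:
  "divdiff y {..Suc m} (\<lambda>x. x ^ Suc n)
     = divdiff y {..m} (\<lambda>x. x ^ n) + y (Suc m) * divdiff y {..Suc m} (\<lambda>x. x ^ n)"
proof -
  have "divdiff y {..Suc m} (\<lambda>x. x ^ Suc n)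
      = divdiff y {..Suc m} (\<lambda>x. (x - y (Suc m)) * x ^ n + y (Suc m) * x ^ n)"
    by (simp add: algebra_simps)
  also have "\<dots> = divdiff y ({..Suc m} - {Suc m}) (\<lambda>x. x ^ n)
      + y (Suc m) * divdiff y {..Suc m} (\<lambda>x. x ^ n)"
    unfolding divdiff_add divdiff_scale
    by (subst divdiff_mult_root) (auto intro: inj_on_subset[OF inj])
  also have "{..Suc m} - {Suc m} = {..m}" by auto
  finally show ?thesis .
qed

lemma divdiff_power_eq_0: "n < m \<Longrightarrow> divdiff y {..m} (\<lambda>x. x ^ n) = 0"
proof (induction n arbitrary: m)
  case 0
  then show ?case by (simp add: divdiff_one_eq_0 inj_on_subset[OF inj])
next
  case (Suc n)
  then obtain k where "m = Suc k" "n < k" by (cases m) auto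
  then show ?case by (simp add: divdiff_power_Suc Suc.IH del: power_Suc)
qed

text \<open>Multiplying the expansion by Y and using Y R_m = R_(m+1) + y_m R_m reproduces the
  recurrence of the coefficients.\<close>

lemma newton_interpolation_power:
  fixes Y :: "'a poly"
  shows "Y ^ n = (\<Sum>m\<le>n. smult (divdiff y {..m} (\<lambda>x. x ^ n)) (\<Prod>i<m. Y - [:y i:]))"
proof (induction n)
  case (Suc n)
  define c where "c = (\<lambda>n m. divdiff y {..m} (\<lambda>x. x ^ n))"
  define R where "R = (\<lambda>m. \<Prod>i<m. Y - [:y i:])"
  have R: "Y * R m = R (Suc m) + smult (y m) (R m)" for m
    by (simp add: R_def algebra_simps)
  have c: "c (Suc n) 0 = y 0 * c n 0" "c (Suc n) (Suc m) = c n m + y (Suc m) * c n (Suc m)"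
    "c n (Suc n) = 0" for m
    unfolding c_def divdiff_power_0 divdiff_power_Suc by (simp_all add: divdiff_power_eq_0)
  have "Y ^ Suc n = (\<Sum>m\<le>n. smult (c n m) (Y * R m))"
    using Suc.IH by (simp add: c_def R_def sum_distrib_left)
  \<comment> \<open>The second sum may run up to \<open>Suc n\<close> since
    \<open>c n (Suc n)\<close> is 0.\<close>
  also have "\<dots> = (\<Sum>m\<le>n. smult (c n m) (R (Suc m))) + (\<Sum>m\<le>Suc n. smult (y m * c n m) (R m))"
    by (simp add: R c(3) smult_add_right sum.distrib mult.commute)
  also have "\<dots> = (\<Sum>m\<le>Suc n. smult (c (Suc n) m) (R m))"
    unfolding sum.atMost_Suc_shift c(1,2)
    by (simp add: smult_add_left sum.distrib)
  finally show ?case by (simp add: c_def R_def)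
qed (simp add: divdiff_power_0[of 0, simplified])

end

section \<open>The moment functional and the Newton basis\<close>

lemma is_AW_functional_AW_functional: "is_AW_functional a b c d q (AW_functional a b c d q)"
  unfolding AW_functional_def by (rule theI'[OF AW_functional_ex1])

lemma AW_functional_eqI: "is_AW_functional a b c d q L \<Longrightarrow> AW_functional a b c d q = L"
  using AW_functional_ex1 is_AW_functional_AW_functional by blast

lemma AW_functional_linear:
  "AW_functional a b c d q (p + r) = AW_functional a b c d q p + AW_functional a b c d q r"
  "AW_functional a b c d q (smult k p) = k * AW_functional a b c d q p"
  using is_AW_functional_AW_functional[of a b c d q]
  unfolding is_AW_functional_def linear_poly_functional_iff by auto

lemma AW_functional_diff:
  "AW_functional a b c d q (p - r) = AW_functional a b c d q p - AW_functional a b c d q r"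
  using AW_functional_linear(1)[of a b c d q "p - r" r] by simp

lemma AW_functional_sum:
  "AW_functional a b c d q (\<Sum>i\<in>I. f i) = (\<Sum>i\<in>I. AW_functional a b c d q (f i))"
proof (induction I rule: infinite_finite_induct)
  case (insert x F)
  then show ?case by (simp add: AW_functional_linear)
qed (use AW_functional_linear(2)[of a b c d q 0 0] in simp_all)

lemma AW_functional_AW_poly:
  "AW_functional a b c d q 1 = 1"
  "AW_functional a b c d q (AW_poly a b c d q (Suc n)) = 0"
  using is_AW_functional_AW_functional[of a b c d q] unfolding is_AW_functional_def by auto

text \<open>With $p = q^2$, \<open>newton_basis a q k\<close> is $\prod_{i<k} (1 - a^2 p^i z^2)(1 - a^2 p^i z^{-2})$ for
  $2x = z + z^{-1}$; it vanishes when $4x^2$ is one of the first $k$ nodes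
  $(a q^i + a^{-1} q^{-i})^2$.\<close>

definition node :: "'a::field \<Rightarrow> 'a \<Rightarrow> nat \<Rightarrow> 'a" where
  "node a q i = (1 + a^2 * q^(2*i))^2 / (a^2 * q^(2*i))"

definition sq4 :: "'a::field poly" where
  "sq4 = smult 4 ([:0, 1:] * [:0, 1:])"

definition newton_basis :: "'a::field \<Rightarrow> 'a \<Rightarrow> nat \<Rightarrow> 'a poly" where
  "newton_basis a q k = (\<Prod>i<k. [:(1 + a^2*q^(2*i))^2:] - smult (a^2*q^(2*i)) sq4)"

section \<open>The symmetric case b = -a, d = -c\<close>

context
  fixes a c q :: "'a::field"
  assumes two: "(2::'a) \<noteq> 0"
    and a: "a \<noteq> 0" and q: "q \<noteq> 0"
    and ac: "\<And>k::nat. a^2 * c^2 * q ^ k \<noteq> 1"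
begin

lemma four_nonzero: "(4::'a) \<noteq> 0"
proof -
  have "(4::'a) = 2 * 2" by simp
  with two show ?thesis by (metis mult_eq_0_iff)
qed

lemma denom_nonzero: "1 - a^2 * c^2 * q^k \<noteq> 0"
  using ac[of k] by auto

text \<open>Here abcd = a^2 c^2, and (1 - acq^n)(1 + acq^n) cancels one denominator;
  \<open>AW_C_eq\<close> uses the same cancellation with n - 1.\<close>

lemma AW_A_eq:
  "AW_A a (-a) c (-c) q n =
     (if n = 0 then (1 + a^2) / a
      else (1 + a^2*q^n) * (1 - a^2*c^2*q^(n-1)) / (a * (1 - a^2*c^2*q^(2*n-1))))"
proof (cases n)
  case 0
  have "(1 - a * c) * (1 + a * c) = 1 - a^2 * c^2"
    by (simp add: algebra_simps power2_eq_square)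
  then show ?thesis
    using 0 denom_nonzero[of 0] a by (simp add: AW_A_def power2_eq_square divide_simps mult_ac)
next
  case (Suc m)
  have "(1 - a*c*q^n) * (1 + a*c*q^n) = 1 - a^2*c^2*q^(2*n)"
    by (simp add: algebra_simps power2_eq_square power_add mult_2 mult_2_right)
  moreover have "a * a * c * c = a^2 * c^2" by (simp add: power2_eq_square)
  ultimately show ?thesis
    using Suc a denom_nonzero[of "2*n"] denom_nonzero[of "2*n-1"]
    unfolding AW_A_def by (simp add: power2_eq_square divide_simps mult_ac)
qed

lemma AW_C_eq:
  "AW_C a (-a) c (-c) q n =
     (if n = 0 then 0 else a * (1 - q^n) * (1 + c^2*q^(n-1)) / (1 - a^2*c^2*q^(2*n-1)))"
proof (cases n)
  case (Suc m)
  have "(1 - a*c*q^m) * (1 + a*c*q^m) = 1 - a^2*c^2*q^(2*m)"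
    by (simp add: algebra_simps power2_eq_square power_add mult_2 mult_2_right)
  then show ?thesis
    using Suc a denom_nonzero[of "2*m"] denom_nonzero[of "2*m+1"]
    unfolding AW_C_def by (simp add: power2_eq_square divide_simps mult_ac)
qed (simp add: AW_C_def)

lemma AW_b_eq_0: "AW_b a (-a) c (-c) q n = 0"
proof -
  have "AW_A a (-a) c (-c) q n + AW_C a (-a) c (-c) q n = a + inverse a"
  proof (cases n)
    case 0
    then show ?thesis using a by (simp add: AW_A_eq AW_C_eq field_simps power2_eq_square)
  next
    case (Suc m)
    define e where "e = 1 - a^2*c^2*q^(2*m+1)"
    have e: "e \<noteq> 0" using denom_nonzero[of "2*m+1"] by (simp add: e_def)
    \<comment> \<open>The numerator of A_n + C_n over the common denominator a e factors through
      e.\<close>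
    have "(1 + a^2*q^Suc m) * (1 - a^2*c^2*q^m) + a^2 * ((1 - q^Suc m) * (1 + c^2*q^m))
        = (1 + a^2) * e"
      by (simp add: e_def algebra_simps power_add mult_2 mult_2_right power2_eq_square)
    moreover have "x / (a * e) + a * y / e = (x + a^2 * y) / (a * e)" for x y
      using a e by (simp add: field_simps power2_eq_square)
    moreover have "(1 + a^2) * e / (a * e) = a + inverse a"
      using a e by (simp add: field_simps power2_eq_square)
    ultimately have "(1 + a^2*q^Suc m) * (1 - a^2*c^2*q^m) / (a * e)
          + a * ((1 - q^Suc m) * (1 + c^2*q^m)) / e = a + inverse a"
      by presburger
    then show ?thesis by (simp add: Suc AW_A_eq AW_C_eq e_def mult.assoc)
  qed
  then show ?thesis by (simp add: AW_b_def)
qed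

lemma AW_lambda_eq:
  assumes "n \<ge> 1"
  shows "4 * AW_lambda a (-a) c (-c) q n = rec_coeff (a^2) (c^2) q n"
proof -
  have 4: "4 * AW_lambda a (-a) c (-c) q n = AW_A a (-a) c (-c) q (n-1) * AW_C a (-a) c (-c) q n"
    using four_nonzero by (simp add: AW_lambda_def)
  consider "n = 1" | m where "n = Suc (Suc m)"
    using assms by (cases n; cases "n - 1") auto
  then show ?thesis
  proof cases
    case 1
    then show ?thesis
      unfolding 4 using a by (simp add: AW_A_eq AW_C_eq rec_coeff_def mult_ac)
  next
    case 2
    have "2 * n - 3 = 2 * m + 1" "2 * n - 1 = 2 * m + 3" using 2 by simp_all
    then show ?thesis
      unfolding 4 using a 2 by (simp add: AW_A_eq AW_C_eq rec_coeff_def mult_ac numeral_3_eq_3)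
  qed
qed

abbreviation "symP \<equiv> AW_poly a (-a) c (-c) q"
abbreviation "symL \<equiv> AW_functional a (-a) c (-c) q"

lemma symP_rec: "symP (Suc (Suc n)) = [:0, 1:] * symP (Suc n) - smult (AW_lambda a (-a) c (-c) q (Suc n)) (symP n)"
  by (simp add: AW_b_eq_0)

text \<open>With b_n = 0 the recurrence preserves parity.\<close>

lemma pcompose_symP: "pcompose (symP n) [:0, -1:] = smult ((-1) ^ n) (symP n)"
proof (induction n rule: induct_nat_012)
  case (ge2 n)
  define X where "X = [:0, 1::'a:]"
  have "pcompose X [:0, -1:] = - X" by (simp add: X_def pcompose_pCons)
  with ge2 show ?case
    unfolding symP_rec X_def[symmetric]
    by (simp add: pcompose_diff pcompose_mult pcompose_smult smult_diff_right mult_ac del: AW_poly.simps)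
qed (simp_all add: pcompose_pCons AW_b_eq_0 pcompose_1)

text \<open>The reflected functional still annihilates every P_n with n >= 1, so uniqueness
  applies.\<close>

lemma symL_reflect: "symL (pcompose p [:0, -1:]) = symL p"
proof -
  have "is_AW_functional a (-a) c (-c) q (\<lambda>p. symL (pcompose p [:0, -1:]))"
    unfolding is_AW_functional_def linear_poly_functional_iff
  proof (intro conjI allI impI)
    fix n :: nat assume "n \<ge> 1"
    then show "symL (pcompose (symP n) [:0, -1:]) = 0"
      by (cases n) (simp_all only: pcompose_symP AW_functional_linear(2) AW_functional_AW_poly, simp_all)
  qed (simp_all add: pcompose_add pcompose_smult pcompose_1 AW_functional_linear AW_functional_AW_poly)
  from AW_functional_eqI[OF this] show ?thesis by metis
qed

lemma odd_moment_eq_0: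
  assumes "odd n"
  shows "AW_moment a (-a) c (-c) q n = 0"
proof -
  have "pcompose (monom 1 n) [:0, -1:] = smult (-1) (monom (1::'a) n)"
  proof -
    have "pcompose ([:0, 1::'a:] ^ n) [:0, -1:] = [:0, -1:] ^ n"
      by (induction n) (simp_all add: pcompose_1 pcompose_mult pcompose_pCons del: mult_pCons_left mult_pCons_right)
    also have "[:0, -1:] = - [:0, 1::'a:]" by simp
    also have "(- [:0, 1::'a:]) ^ n = - ([:0, 1:] ^ n)"
      using assms by (rule power_minus_odd)
    finally show ?thesis by (simp add: monom_altdef)
  qed
  with symL_reflect[of "monom 1 n"] have "- symL (monom 1 n) = symL (monom 1 n)"
    by (simp only: AW_functional_linear) simp
  then have "2 * symL (monom 1 n) = 0"
    unfolding mult_2 by (metis add.right_inverse)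
  with two show ?thesis by (simp add: AW_moment_def)
qed

text \<open>The recurrence of P_n, split by parity and scaled by powers of 4, supplies the
  hypotheses of \<open>mixed_moments_eqI\<close>; only row n = 0 is wanted in the end.\<close>

lemma symL_newton_basis: "symL (newton_basis a q k) = even_mixed (a^2) (c^2) q 0 k"
proof -
  define X where "X = [:0, 1::'a:]"
  note symP_rec = symP_rec[folded X_def]
  have sq4: "sq4 = smult 4 (X * X)" by (simp only: sq4_def X_def)
  define E where "E n = smult (4^n) (symP (2*n))" for n
  \<comment> \<open>The extra factor x makes F_n an even polynomial, like E_n.\<close>
  define F where "F n = smult (4^(n+1)) (X * symP (2*n+1))" for n
  have E: "E (Suc n) = F n - smult (rec_coeff (a^2) (c^2) q (2*n+1)) (E n)" for n
    unfolding E_def F_def AW_lambda_eq[symmetric, OF le_add2]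
    using symP_rec[of "2*n"] by (simp add: smult_diff_right mult_ac del: AW_poly.simps)
  have F0: "F 0 = sq4 * E 0"
    unfolding E_def F_def sq4 by (simp add: AW_b_eq_0 X_def[symmetric])
  have F: "F (Suc n) = sq4 * E (Suc n) - smult (rec_coeff (a^2) (c^2) q (2*n+2)) (F n)" for n
  proof -
    have "rec_coeff (a^2) (c^2) q (2*n+2) = 4 * AW_lambda a (-a) c (-c) q (2*n+2)"
      by (simp add: AW_lambda_eq)
    then show ?thesis
      unfolding E_def F_def sq4
      using symP_rec[of "2*n+1"]
      by (simp add: smult_diff_right mult_ac right_diff_distrib del: AW_poly.simps)
  qed
  define M where "M n k = symL (E n * newton_basis a q k)" for n k
  define N where "N n k = symL (F n * newton_basis a q k)" for n k
  have "newton_basis a q (Suc k) = smult ((1 + a^2*q^(2*k))^2) (newton_basis a q k)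
      - smult (a^2*q^(2*k)) (sq4 * newton_basis a q k)" for k
    unfolding newton_basis_def by (simp add: algebra_simps)
  then have M: "M n (Suc k) = (1 + a^2*q^(2*k))^2 * M n k - a^2*q^(2*k) * symL (sq4 * E n * newton_basis a q k)" for n k
    unfolding M_def by (simp add: right_diff_distrib AW_functional_diff AW_functional_linear mult_ac)
  have "M 0 k = even_mixed (a^2) (c^2) q 0 k"
  proof (rule mixed_moments_eqI[OF ac])
    show "M 0 0 = 1" by (simp add: M_def E_def newton_basis_def AW_functional_AW_poly one_pCons[symmetric])
    show "M (Suc n) 0 = 0" for n
      \<comment> \<open>The index is one less than that of P_(2n+2), because the fact is stated with
        \<open>Suc\<close>.\<close>
      using AW_functional_AW_poly(2)[of a "-a" c "-c" q "2*n+1"]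
      by (simp add: M_def E_def newton_basis_def AW_functional_linear del: AW_poly.simps)
    show "N n k = M (Suc n) k + rec_coeff (a^2) (c^2) q (2*n+1) * M n k" for n k
      unfolding M_def N_def E by (simp add: left_diff_distrib AW_functional_diff AW_functional_linear)
    show "M 0 (Suc k) = (1 + a^2*q^(2*k))^2 * M 0 k - a^2*q^(2*k) * N 0 k" for k
      unfolding M N_def F0 ..
    show "M (Suc n) (Suc k) = (1 + a^2*q^(2*k))^2 * M (Suc n) k
         - a^2*q^(2*k) * (N (Suc n) k + rec_coeff (a^2) (c^2) q (2*n+2) * N n k)" for n k
      unfolding M N_def F by (simp add: left_diff_distrib AW_functional_diff AW_functional_linear)
  qed
  then show ?thesis by (simp add: M_def E_def)
qed

lemma newton_basis_eq:
  "newton_basis a q k = smult (\<Prod>i<k. - (a^2*q^(2*i))) (\<Prod>i<k. sq4 - [:node a q i:])"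
proof (induction k)
  case (Suc k)
  have "[:(1 + a^2*q^(2*k))^2:] - smult (a^2*q^(2*k)) sq4 = smult (- (a^2*q^(2*k))) (sq4 - [:node a q k:])"
    using a q by (simp add: node_def smult_diff_right)
  with Suc show ?case by (simp add: newton_basis_def mult_ac)
qed (simp add: newton_basis_def)

lemma even_moment_newton:
  assumes "inj (node a q)"
  shows "4^n * AW_moment a (-a) c (-c) q (2*n) =
    (\<Sum>m\<le>n. divdiff (node a q) {..m} (\<lambda>x. x^n) / (\<Prod>i<m. - (a^2*q^(2*i)))
        * even_mixed (a^2) (c^2) q 0 m)"
proof -
  have "smult (4^n) (monom 1 (2*n)) = sq4 ^ n"
    unfolding sq4_def monom_altdef power_mult power2_eq_square smult_1_left smult_power ..
  also have "\<dots> = (\<Sum>m\<le>n. smult (divdiff (node a q) {..m} (\<lambda>x. x^n)) (\<Prod>i<m. sq4 - [:node a q i:]))"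
    by (rule newton_interpolation_power[OF assms])
  also have "\<dots> = (\<Sum>m\<le>n. smult (divdiff (node a q) {..m} (\<lambda>x. x^n) / (\<Prod>i<m. - (a^2*q^(2*i)))) (newton_basis a q m))"
    using a q by (intro sum.cong refl) (simp add: newton_basis_eq prod_zero_iff)
  finally have "symL (smult (4^n) (monom 1 (2*n))) =
    (\<Sum>m\<le>n. divdiff (node a q) {..m} (\<lambda>x. x^n) / (\<Prod>i<m. - (a^2*q^(2*i))) * symL (newton_basis a q m))"
    by (simp only: AW_functional_sum AW_functional_linear)
  then show ?thesis
    by (simp only: AW_functional_linear symL_newton_basis AW_moment_def)
qed

end

section \<open>Node differences and interpolation weights\<close>

text \<open>The left side is the i-th factor of the Newton basis at node j, so it splits as (1 - a^2
  q^(2i) z^2)(1 - a^2 q^(2i) z^(-2)) with z = a q^j.\<close>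

lemma node_diff:
  assumes "a \<noteq> 0" and "q \<noteq> 0"
  shows "- (a^2*q^(2*i)) * (node a q j - node a q i) = (1 - a^4*q^(2*(i+j))) * (1 - q^(2*i) / q^(2*j))"
proof -
  define u v where "u = q^(2*i)" and "v = q^(2*j)"
  have "u \<noteq> 0" "v \<noteq> 0" using assms by (simp_all add: u_def v_def)
  then have "- (a^2*u) * ((1 + a^2*v)^2 / (a^2*v) - (1 + a^2*u)^2 / (a^2*u)) = (1 - a^4*(u*v)) * (1 - u/v)"
    using assms by (simp add: field_simps) algebra
  moreover have "q^(2*(i+j)) = u*v" by (simp add: u_def v_def power_add algebra_simps)
  ultimately show ?thesis by (simp add: node_def u_def v_def)
qed

lemma qpoch2_eq_prod: "qpoch2 x y p m = (\<Prod>i<m. (1 - x * p^i) * (1 - y * p^i))"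
  by (simp add: qpoch2_def qpoch_def prod.distrib)

lemma node_prod_above:
  fixes a q :: "'a::field"
  assumes "a \<noteq> 0" and "q \<noteq> 0" and "j \<le> m"
  shows "(\<Prod>i\<in>{j<..m}. - (a^2*q^(2*i)) * (node a q j - node a q i))
    = qpoch2 (q^2) (a^4*q^(2+4*j)) (q^2) (m - j)"
  unfolding qpoch2_eq_prod node_diff[OF assms(1,2)]
proof (rule prod.reindex_bij_witness[of _ "\<lambda>l. Suc (j + l)" "\<lambda>i. i - Suc j"])
  fix i assume i: "i \<in> {j<..m}"
  define l where "l = i - Suc j"
  have il: "i = Suc (j + l)" using i by (simp add: l_def)
  have "q^(2*i) / q^(2*j) = q^2 * (q^2)^l"
    using assms(2) by (simp add: il power_add power_mult power2_eq_square)
  moreover have "q^(2*(i+j)) = q^(2+4*j) * (q^2)^l"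
    by (simp add: il power_mult[symmetric] power_add[symmetric] power_Suc[symmetric] ac_simps del: power_Suc)
  ultimately show "(1 - q^2 * (q^2)^(i - Suc j)) * (1 - a^4*q^(2+4*j) * (q^2)^(i - Suc j))
      = (1 - a^4*q^(2*(i+j))) * (1 - q^(2*i) / q^(2*j))"
    unfolding l_def[symmetric] by (simp only: mult_ac)
qed auto

text \<open>Reversing the order by l = j - 1 - i leaves inverse arguments in both factors of
  \<open>node_diff\<close>. Inverting them releases a^4 q^(4i) each time; the prefactor q^(2j)
  completes the exponent 2j(j-1) to 2j^2.\<close>

lemma node_prod_below:
  fixes a q :: "'a::field"
  assumes "a \<noteq> 0" and "q \<noteq> 0"
  shows "q^(2*j) * (\<Prod>i<j. - (a^2*q^(2*i)) * (node a q j - node a q i))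
    = a^(4*j) * q^(2*j^2) * qpoch2 (q^2) (a powi (-4) * q powi (2 - 4 * int j)) (q^2) j"
proof -
  let ?Q = "\<lambda>l. (1 - q^2 * (q^2)^l) * (1 - a powi (-4) * q powi (2 - 4 * int j) * (q^2)^l)"
  have "(\<Prod>i<j. - (a^2*q^(2*i)) * (node a q j - node a q i))
      = (\<Prod>i<j. a^4*q^(4*i) * ?Q (j - Suc i))"
  proof (intro prod.cong refl)
    fix i assume "i \<in> {..<j}"
    define l where "l = j - Suc i"
    have jl: "j = Suc (i + l)" using \<open>i \<in> {..<j}\<close> by (simp add: l_def)
    define u where "u = q^(2*(i+j))"
    have u: "u \<noteq> 0" "a^4 * u \<noteq> 0" using assms by (simp_all add: u_def)
    have "q powi (2 - 4 * int j) * (q^2)^l = q powi (2 - 4 * int j + int (2*l))"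
      using assms by (simp only: power_int_add power_int_of_nat power_mult simp_thms)
    also have "2 - 4 * int j + int (2*l) = - int (2*(i+j))" by (simp add: jl)
    finally have Q2: "a powi (-4) * q powi (2 - 4 * int j) * (q^2)^l = 1 / (a^4 * u)"
      unfolding power_int_minus power_int_of_nat u_def[symmetric] mult.assoc
      using assms(1) by (simp add: power_int_minus divide_inverse)
    have v: "q^(2*j) = q^2 * (q^2)^l * q^(2*i)" "q^(2*i) \<noteq> 0" "q^2 * (q^2)^l \<noteq> 0"
      using assms by (simp_all add: jl power_add power_mult power2_eq_square)
    have w: "q^(4*i) * (q^2 * (q^2)^l) = u"
      unfolding u_def jl
      by (simp add: power_mult[symmetric] power_add[symmetric] power_Suc[symmetric] ac_simps del: power_Suc)
    have "(1 - a^4 * u) * (1 - 1 / (q^2 * (q^2)^l))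
        = a^4 * q^(4*i) * ((1 - q^2 * (q^2)^l) * (1 - 1 / (a^4 * u)))"
    proof -
      have "(1 - A*(w*s)) * (1 - 1/s) = A * w * ((1 - s) * (1 - 1 / (A*(w*s))))"
        if "A \<noteq> 0" "w \<noteq> 0" "s \<noteq> 0" for A w s :: 'a
        using that by (simp add: field_simps)
      from this[of "a^4" "q^(4*i)" "q^2 * (q^2)^l"] show ?thesis
        using assms v by (simp add: w)
    qed
    then show "- (a^2*q^(2*i)) * (node a q j - node a q i) = a^4*q^(4*i) * ?Q (j - Suc i)"
      unfolding node_diff[OF assms] l_def[symmetric] Q2 u_def[symmetric] v(1)
      using v(2) by simp
  qed
  also have "\<dots> = (\<Prod>i<j. a^4*q^(4*i)) * (\<Prod>l<j. ?Q l)"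
    unfolding prod.distrib[of "\<lambda>i. a^4*q^(4*i)" "\<lambda>i. ?Q (j - Suc i)"] prod.nat_diff_reindex[of ?Q] ..
  finally have 1: "(\<Prod>i<j. - (a^2*q^(2*i)) * (node a q j - node a q i))
      = (\<Prod>i<j. a^4*q^(4*i)) * (\<Prod>l<j. ?Q l)" .
  have 2: "q^(2*j) * (\<Prod>i<j. a^4*q^(4*i)) = a^(4*j) * q^(2*j^2)"
  proof (induction j)
    case (Suc j)
    have e: "2 * (Suc j)^2 = 2 * j^2 + 4 * j + 2" "4 * Suc j = 4 * j + 4" "2 * Suc j = 2 * j + 2"
      by (simp_all add: power2_eq_square)
    have "q^(2 * Suc j) * (\<Prod>i<Suc j. a^4*q^(4*i))
        = (q^(2*j) * (\<Prod>i<j. a^4*q^(4*i))) * (q^2 * a^4 * q^(4*j))"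
      unfolding e power_add prod.lessThan_Suc by (simp only: mult_ac)
    then show ?case
      unfolding Suc.IH e power_add by (simp only: mult_ac)
  qed simp
  show ?thesis
    unfolding qpoch2_eq_prod 1 2[symmetric] by (simp only: mult_ac)
qed

text \<open>The leading coefficients omit index m, the node differences omit index j. Exchanging the
  two costs q^(2m) against q^(2j), which is where the outer power q^(2m) originates.\<close>

lemma newton_weight:
  fixes a q :: "'a::field"
  assumes "a \<noteq> 0" and "q \<noteq> 0" and "j \<le> m"
  shows "q^(2*m) * ((\<Prod>i<m. - (a^2*q^(2*i))) * (\<Prod>i\<in>{..m} - {j}. node a q j - node a q i))
    = a^(4*j) * q^(2*j^2) * (qpoch2 (q^2) (a^4 * q^(2+4*j)) (q^2) (m - j)
        * qpoch2 (q^2) (a powi (-4) * q powi (2 - 4 * int j)) (q^2) j)"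
proof -
  define g h where "g = (\<lambda>i. - (a^2*q^(2*i)))" and "h = (\<lambda>i. node a q j - node a q i)"
  have "prod g {..<m} * g m = prod g {..m}" by (simp add: lessThan_Suc_atMost[symmetric])
  also have "\<dots> = g j * prod g ({..m} - {j})" using assms(3) by (intro prod.remove) auto
  finally have "(- (a^2)) * (q^(2*m) * prod g {..<m}) = (- (a^2)) * (q^(2*j) * prod g ({..m} - {j}))"
    by (simp add: g_def mult_ac)
  then have "q^(2*m) * prod g {..<m} = q^(2*j) * prod g ({..m} - {j})"
    using assms(1) by simp
  then have "q^(2*m) * (prod g {..<m} * prod h ({..m} - {j})) = q^(2*j) * (\<Prod>i\<in>{..m} - {j}. g i * h i)"
    by (simp add: prod.distrib mult.assoc[symmetric])
  also have "(\<Prod>i\<in>{..m} - {j}. g i * h i) = (\<Prod>i\<in>{..<j} \<union> {j<..m}. g i * h i)"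
    using assms(3) by (intro prod.cong) auto
  also have "\<dots> = (\<Prod>i<j. g i * h i) * (\<Prod>i\<in>{j<..m}. g i * h i)"
    by (intro prod.union_disjoint) auto
  finally show ?thesis
    unfolding g_def h_def node_prod_above[OF assms] mult.assoc[symmetric] node_prod_below[OF assms(1,2)]
    by (simp only: mult_ac)
qed

text \<open>For i < j both factors in \<open>node_diff\<close> are nonzero, with i + j >= 1.\<close>

lemma inj_node:
  fixes a q :: "'a::field"
  assumes "a \<noteq> 0" and "q \<noteq> 0"
    and q_not_root: "\<And>k::nat. k \<ge> 1 \<Longrightarrow> q ^ k \<noteq> 1"
    and "\<And>k::nat. k \<ge> 1 \<Longrightarrow> a^4 * q ^ (2*k) \<noteq> 1"
  shows "inj (node a q)"
proof (rule linorder_injI)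
  fix i j :: nat assume "i < j"
  have "q^(2*j) = q^(2*i) * q^(2*(j-i))"
    using \<open>i < j\<close> by (simp flip: power_add mult_2 distrib_left)
  with \<open>i < j\<close> assms(2) q_not_root[of "2*(j-i)"] have "1 - q^(2*i) / q^(2*j) \<noteq> 0"
    by auto
  moreover have "1 - a^4*q^(2*(i+j)) \<noteq> 0"
    using assms(4)[of "i+j"] \<open>i < j\<close> by auto
  ultimately have "- (a^2*q^(2*i)) * (node a q j - node a q i) \<noteq> 0"
    unfolding node_diff[OF assms(1,2)] by (rule no_zero_divisors[rotated])
  then show "node a q i \<noteq> node a q j" by auto
qed

text \<open>Genericity becomes explicit conditions in any field: those on q^k and a^4 q^(2k)
  separate the nodes, and the one on a^2 c^2 q^k keeps the denominators of the recurrence and of the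
  closed forms nonzero.\<close>

theorem theorem2p7:
  fixes a c q :: "'a::field" and n :: nat
  assumes "(2::'a) \<noteq> 0"
    and "a \<noteq> 0" and "q \<noteq> 0"
    and "\<And>k::nat. k \<ge> 1 \<Longrightarrow> q ^ k \<noteq> 1"
    and "\<And>k::nat. a^2 * c^2 * q ^ k \<noteq> 1"
    and "\<And>k::nat. k \<ge> 1 \<Longrightarrow> a^4 * q ^ (2*k) \<noteq> 1"
  shows "AW_moment a (-a) c (-c) q (2*n + 1) = 0 \<and>
    4 ^ n * AW_moment a (-a) c (-c) q (2*n) =
      (\<Sum>m=0..n. qpoch (- (a^2)) q (2*m) * qpoch (a^2 * c^2) (q^2) m
                  / qpoch (q * a^2 * c^2) (q^2) m * q ^ (2*m) *
         (\<Sum>j=0..m. a powi (- 4 * int j) * q powi (- 2 * (int j)^2)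
                     * (a * q ^ j + a powi (- 1) * q powi (- int j)) ^ (2*n)
                  / (qpoch2 (q^2) (a^4 * q ^ (2 + 4*j)) (q^2) (m - j)
                     * qpoch2 (q^2) (a powi (- 4) * q powi (2 - 4 * int j)) (q^2) j)))"
proof (intro conjI)
  show "AW_moment a (-a) c (-c) q (2*n + 1) = 0"
    using odd_moment_eq_0[OF assms(1-3,5)] by simp
  let ?w = "\<lambda>m j. a powi (- 4 * int j) * q powi (- 2 * (int j)^2)
                     * (a * q ^ j + a powi (- 1) * q powi (- int j)) ^ (2*n)
                  / (qpoch2 (q^2) (a^4 * q ^ (2 + 4*j)) (q^2) (m - j)
                     * qpoch2 (q^2) (a powi (- 4) * q powi (2 - 4 * int j)) (q^2) j)"
  \<comment> \<open>Up to q^(2m), the inner summand is the Lagrange term of the divided difference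
    over the leading coefficient of f_m in Y.\<close>
  have w: "q^(2*m) * ?w m j = node a q j ^ n / (\<Prod>i\<in>{..m} - {j}. node a q j - node a q i)
      / (\<Prod>i<m. - (a^2*q^(2*i)))" if "j \<le> m" for m j
  proof -
    let ?R = "qpoch2 (q^2) (a^4 * q ^ (2 + 4*j)) (q^2) (m - j)
                     * qpoch2 (q^2) (a powi (- 4) * q powi (2 - 4 * int j)) (q^2) j"
    let ?G = "\<Prod>i<m. - (a^2*q^(2*i))" and ?H = "\<Prod>i\<in>{..m} - {j}. node a q j - node a q i"
    have R: "q^(2*m) * (?G * ?H) = a^(4*j) * q^(2*j^2) * ?R"
      by (rule newton_weight[OF assms(2,3) that])
    have "- 4 * int j = - int (4*j)" "- 2 * (int j)^2 = - int (2*j^2)" by simp_all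
    then have p: "a powi (- 4 * int j) * q powi (- 2 * (int j)^2) = 1 / (a^(4*j) * q^(2*j^2))"
      by (simp only: power_int_minus power_int_of_nat) (simp add: divide_inverse)
    have "(a * q ^ j + a powi (- 1) * q powi (- int j))^2 = node a q j"
    proof -
      have "q^(2*j) = (q^j)^2" by (simp add: power_mult[symmetric] mult.commute)
      then show ?thesis
        using assms(2,3) by (simp add: node_def power_int_minus field_simps power2_eq_square)
    qed
    then have y: "(a * q ^ j + a powi (- 1) * q powi (- int j)) ^ (2*n) = node a q j ^ n"
      by (simp add: power_mult)
    have "?w m j = node a q j ^ n / (a^(4*j) * q^(2*j^2) * ?R)"
      unfolding p y by simp
    also have "\<dots> = node a q j ^ n / (q^(2*m) * (?G * ?H))"
      unfolding R ..
    finally show ?thesis using assms(3) by (simp add: mult_ac)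
  qed
  have "4 ^ n * AW_moment a (-a) c (-c) q (2*n) =
    (\<Sum>m\<le>n. divdiff (node a q) {..m} (\<lambda>x. x^n) / (\<Prod>i<m. - (a^2*q^(2*i)))
        * even_mixed (a^2) (c^2) q 0 m)"
    by (intro even_moment_newton inj_node assms)
  also have "\<dots> = (\<Sum>m\<le>n. qpoch (- (a^2)) q (2*m) * qpoch (a^2 * c^2) (q^2) m
                  / qpoch (q * a^2 * c^2) (q^2) m * (q ^ (2*m) * (\<Sum>j\<le>m. ?w m j)))"
  proof (intro sum.cong refl)
    fix m
    have "divdiff (node a q) {..m} (\<lambda>x. x^n) / (\<Prod>i<m. - (a^2*q^(2*i)))
        = q^(2*m) * (\<Sum>j\<le>m. ?w m j)"
      unfolding divdiff_def sum_divide_distrib sum_distrib_left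
      by (intro sum.cong refl w[symmetric]) simp
    then show "divdiff (node a q) {..m} (\<lambda>x. x^n) / (\<Prod>i<m. - (a^2*q^(2*i)))
        * even_mixed (a^2) (c^2) q 0 m
      = qpoch (- (a^2)) q (2*m) * qpoch (a^2 * c^2) (q^2) m
                  / qpoch (q * a^2 * c^2) (q^2) m * (q ^ (2*m) * (\<Sum>j\<le>m. ?w m j))"
      \<comment> \<open>At n = 0 both \<open>norm_const\<close> and \<open>lowfac\<close> are 1, so
        only the outer factor of the sum remains.\<close>
      by (simp only: even_mixed_def) (simp add: mult_ac)
  qed
  finally show "4 ^ n * AW_moment a (-a) c (-c) q (2*n) =
      (\<Sum>m=0..n. qpoch (- (a^2)) q (2*m) * qpoch (a^2 * c^2) (q^2) m
                  / qpoch (q * a^2 * c^2) (q^2) m * q ^ (2*m) * (\<Sum>j=0..m. ?w m j))"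
    by (simp only: atLeast0AtMost mult.assoc)
qed

end
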